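(* Let $\mathcal{A}$ be a complex Banach algebra with unit $1$, let $a\in\mathcal{A}$ and let $n\in\mathbb{N}$. Then $a$ is generalized $n$-strongly Drazin invertible if and only if $a-a^{n+1}\in\mathcal{A}^{qnil}$.
   Context: $\mathbb{N}$ is the set of positive integers. $\mathcal{A}^{qnil}=\{a\in\mathcal{A}:\lim_{m\to\infty}\|a^m\|^{1/m}=0\}=\{a\in\mathcal{A}:\sigma(a)=\{0\}\}$ is the set of quasinilpotent elements. $\mathrm{Comm}(a)=\{x\in\mathcal{A}:xa=ax\}$ and $\mathrm{Comm}^2(a)=\{x\in\mathcal{A}: xy=yx \text{ for all } y\in\mathrm{Comm}(a)\}$. An element $a\in\mathcal{A}$ is generalized $n$-strongly Drazin invertible (g$n$s-Drazin invertible) if there exists $x\in\mathcal{A}$ such that $x\in\mathrm{Comm}^2(a)$, $xax=x$ and $a^n-ax\in\mathcal{A}^{qnil}$. *)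

theory Defs
  imports "HOL-Analysis.Analysis"
begin

text \<open>
  The library has only real normed algebras, so the complex scalar multiplication is added here,
  compatibly with the real one. The unit is not required to have norm 1, which is why
  \<^class>\<open>real_normed_algebra_1\<close> is not used. As usual in \<^class>\<open>ring_1\<close>, the
  zero algebra is excluded.
\<close>

class complex_banach_algebra_1 = real_normed_algebra + ring_1 + banach +
  fixes scaleC :: "complex \<Rightarrow> 'a \<Rightarrow> 'a" (infixr \<open>*\<^sub>C\<close> 75)
  assumes scaleC_add_right: "c *\<^sub>C (x + y) = c *\<^sub>C x + c *\<^sub>C y"
    and scaleC_add_left: "(c + d) *\<^sub>C x = c *\<^sub>C x + d *\<^sub>C x"
    and scaleC_scaleC: "c *\<^sub>C d *\<^sub>C x = (c * d) *\<^sub>C x"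
    and scaleC_one: "1 *\<^sub>C x = x"
    and scaleR_scaleC: "r *\<^sub>R x = complex_of_real r *\<^sub>C x"
    and mult_scaleC_left: "(c *\<^sub>C x) * y = c *\<^sub>C (x * y)"
    and mult_scaleC_right: "x * (c *\<^sub>C y) = c *\<^sub>C (x * y)"
    and norm_scaleC: "norm (c *\<^sub>C x) = cmod c * norm x"

instantiation complex :: complex_banach_algebra_1
begin

definition scaleC_complex :: "complex \<Rightarrow> complex \<Rightarrow> complex" where
  "scaleC_complex c x = c * x"

instance
  by standard
    (simp_all add: scaleC_complex_def algebra_simps norm_mult scaleR_conv_of_real)

end

definition quasinilpotents :: "'a::complex_banach_algebra_1 set" where
  "quasinilpotents = {a. (\<lambda>m. root m (norm (a ^ m))) \<longlonglongrightarrow> 0}"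

definition Comm :: "'a::complex_banach_algebra_1 \<Rightarrow> 'a set" where
  "Comm a = {x. x * a = a * x}"

definition Comm2 :: "'a::complex_banach_algebra_1 \<Rightarrow> 'a set" where
  "Comm2 a = {x. \<forall>y\<in>Comm a. x * y = y * x}"

definition gns_Drazin_invertible :: "nat \<Rightarrow> 'a::complex_banach_algebra_1 \<Rightarrow> bool" where
  "gns_Drazin_invertible n a \<longleftrightarrow>
     (\<exists>x. x \<in> Comm2 a \<and> x * a * x = x \<and> a ^ n - a * x \<in> quasinilpotents)"

end

theory Submission
  imports Defs
begin

text \<open>
  Everything reduces to \<open>c = a ^ n\<close>. The element \<open>a - a ^ (n + 1) = a * (1 - c)\<close> divides
  \<open>c - c * c\<close> and its \<open>n\<close>-th power is a multiple of \<open>c - c * c\<close>, all inside the algebra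
  generated by \<open>a\<close>; so one of them is quasinilpotent exactly when the other is
  (\<open>quasinilpotent_diff_power_Suc_iff\<close>).

  If \<open>x\<close> is a generalized strong Drazin inverse, then \<open>p = a * x\<close> is an idempotent commuting with
  \<open>c\<close> and \<open>c - c * c = (c - p) * (1 - c - p)\<close>, a multiple of a quasinilpotent.

  Conversely, an element with \<open>c - c * c\<close> quasinilpotent is a quasinilpotent perturbation of an
  idempotent \<open>p\<close> in its bicommutant (\<open>idempotent_lifting\<close>). The substitution \<open>h = 2 c - 1\<close> turns
  idempotents into involutions; \<open>h * h\<close> is then \<open>1 + y\<close> with \<open>y\<close> quasinilpotent, and
  \<open>h (1 + y) powr (-1/2)\<close> is the required involution. The power is given by the binomial series,
  which converges at every quasinilpotent. Finally \<open>c * p = p * (1 + (c - p))\<close> shows that \<open>c\<close>,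
  hence \<open>a\<close>, is invertible in the corner of \<open>p\<close>, and \<open>x = a ^ (n - 1) * p / (1 + (c - p))\<close> is its
  inverse there.
\<close>

section \<open>Quasinilpotent elements\<close>

text \<open>
  Bounds on all powers, with a constant in front, are easier to multiply and to sum than limits of
  roots; the constant disappears in the limit because its \<open>m\<close>-th roots tend to 1.
\<close>

lemma quasinilpotents_iff_geometric_bound:
  fixes a :: "'a::complex_banach_algebra_1"
  shows "a \<in> quasinilpotents \<longleftrightarrow> (\<forall>e>0. \<exists>C. \<forall>m. norm (a ^ m) \<le> C * e ^ m)"
proof (intro iffI allI impI)
  fix e :: real assume a: "a \<in> quasinilpotents" and e: "e > 0"
  have "\<forall>\<^sub>F m in sequentially. root m (norm (a ^ m)) < e"
    using a e order_tendstoD(2) unfolding quasinilpotents_def by blast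
  then obtain N where N: "\<And>m. m \<ge> N \<Longrightarrow> root m (norm (a ^ m)) < e"
    unfolding eventually_sequentially by blast
  define C where "C = 1 + (\<Sum>m\<le>N. norm (a ^ m) / e ^ m)"
  have nonneg: "(\<Sum>m\<le>N. norm (a ^ m) / e ^ m) \<ge> 0"
    using e by (intro sum_nonneg) auto
  have "norm (a ^ m) \<le> C * e ^ m" for m
  proof (cases "m \<le> N")
    case True
    have "norm (a ^ m) / e ^ m \<le> (\<Sum>m\<le>N. norm (a ^ m) / e ^ m)"
      using e True by (intro member_le_sum) auto
    then have "norm (a ^ m) / e ^ m \<le> C"
      by (simp add: C_def)
    then show ?thesis
      using e by (simp add: field_simps)
  next
    case False
    then have "norm (a ^ m) = root m (norm (a ^ m)) ^ m"
      by simp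
    also have "\<dots> \<le> e ^ m"
      using N[of m] False by (intro power_mono) auto
    also have "\<dots> \<le> C * e ^ m"
      using e nonneg by (simp add: C_def)
    finally show ?thesis .
  qed
  then show "\<exists>C. \<forall>m. norm (a ^ m) \<le> C * e ^ m"
    by blast
next
  assume bound: "\<forall>e>0. \<exists>C. \<forall>m. norm (a ^ m) \<le> C * e ^ m"
  have "(\<lambda>m. root m (norm (a ^ m))) \<longlonglongrightarrow> 0"
  proof (rule order_tendstoI)
    fix r :: real assume "r < 0"
    then show "\<forall>\<^sub>F m in sequentially. r < root m (norm (a ^ m))"
      by (auto intro!: always_eventually less_le_trans[of r 0] real_root_ge_zero)
  next
    fix r :: real assume r: "0 < r"
    then obtain C where C: "\<And>m. norm (a ^ m) \<le> C * (r / 2) ^ m"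
      using bound[rule_format, of "r / 2"] by auto
    define D where "D = max C 1"
    have "(\<lambda>m. root m D * (r / 2)) \<longlonglongrightarrow> 1 * (r / 2)"
      by (intro tendsto_intros LIMSEQ_root_const) (simp add: D_def)
    then have "\<forall>\<^sub>F m in sequentially. root m D * (r / 2) < r"
      by (rule order_tendstoD(2)) (use r in simp)
    then show "\<forall>\<^sub>F m in sequentially. root m (norm (a ^ m)) < r"
      using eventually_gt_at_top[of 0]
    proof eventually_elim
      case (elim m)
      have "norm (a ^ m) \<le> D * (r / 2) ^ m"
        using C[of m] r by (smt (verit) D_def mult_right_mono zero_le_power half_gt_zero_iff)
      then have "root m (norm (a ^ m)) \<le> root m (D * (r / 2) ^ m)"
        using elim by simp
      also have "\<dots> = root m D * (r / 2)"
        using elim r by (simp add: real_root_mult real_root_power_cancel)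
      finally show ?case
        using elim by simp
    qed
  qed
  then show "a \<in> quasinilpotents"
    by (simp add: quasinilpotents_def)
qed

lemma quasinilpotents_bound:
  fixes a :: "'a::complex_banach_algebra_1"
  assumes "a \<in> quasinilpotents" "e > 0"
  obtains C where "C \<ge> 0" "\<And>m. norm (a ^ m) \<le> C * e ^ m"
proof -
  obtain C where C: "\<And>m. norm (a ^ m) \<le> C * e ^ m"
    using assms quasinilpotents_iff_geometric_bound by blast
  have "0 \<le> C"
    using C[of 0] by (simp add: order_trans[OF norm_ge_zero])
  with C that show ?thesis
    by blast
qed

text \<open>
  The factor \<open>norm 1\<close> accounts for \<open>m = 0\<close>, since the unit may have any norm \<open>\<ge> 1\<close>.
\<close>

lemma norm_power_le:
  fixes a :: "'a::complex_banach_algebra_1"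
  shows "norm (a ^ m) \<le> norm (1::'a) * norm a ^ m"
proof (induction m)
  case (Suc m)
  have "norm (a ^ Suc m) \<le> norm a * norm (a ^ m)"
    by (simp add: norm_mult_ineq)
  also have "\<dots> \<le> norm a * (norm (1::'a) * norm a ^ m)"
    by (intro mult_left_mono Suc) auto
  finally show ?case
    by (simp add: mult_ac)
qed simp

lemma power_mult_distrib_commuting:
  fixes a b :: "'a::monoid_mult"
  assumes "a * b = b * a"
  shows "(a * b) ^ m = a ^ m * b ^ m"
proof (induction m)
  case (Suc m)
  have "(a * b) ^ Suc m = a * (b * a ^ m) * b ^ m"
    by (simp add: Suc mult.assoc)
  also have "b * a ^ m = a ^ m * b"
    using power_commuting_commutes[OF assms] by simp
  finally show ?case
    by (simp add: mult.assoc)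
qed simp

lemma quasinilpotents_mult_commuting:
  fixes a b :: "'a::complex_banach_algebra_1"
  assumes a: "a \<in> quasinilpotents" and comm: "a * b = b * a"
  shows "a * b \<in> quasinilpotents"
  unfolding quasinilpotents_iff_geometric_bound
proof (intro allI impI)
  fix e :: real assume e: "e > 0"
  define d where "d = e / (norm b + 1)"
  have nb: "norm b + 1 > 0"
    by (smt (verit) norm_ge_zero)
  then have d: "d > 0" "d * norm b \<le> e"
    using e by (auto simp: d_def field_simps)
  obtain C where C: "C \<ge> 0" "\<And>m. norm (a ^ m) \<le> C * d ^ m"
    using quasinilpotents_bound[OF a d(1)] by blast
  have "norm ((a * b) ^ m) \<le> C * norm (1::'a) * e ^ m" for m
  proof -
    have "norm ((a * b) ^ m) \<le> norm (a ^ m) * norm (b ^ m)"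
      by (simp add: power_mult_distrib_commuting[OF comm] norm_mult_ineq)
    also have "\<dots> \<le> (C * d ^ m) * (norm (1::'a) * norm b ^ m)"
      using C d by (intro mult_mono norm_power_le) auto
    also have "\<dots> = C * norm (1::'a) * (d * norm b) ^ m"
      by (simp add: power_mult_distrib)
    also have "\<dots> \<le> C * norm (1::'a) * e ^ m"
      using C d by (intro mult_left_mono power_mono) auto
    finally show ?thesis .
  qed
  then show "\<exists>C. \<forall>m. norm ((a * b) ^ m) \<le> C * e ^ m"
    by blast
qed

lemma quasinilpotents_scaleR:
  fixes a :: "'a::complex_banach_algebra_1"
  assumes "a \<in> quasinilpotents"
  shows "r *\<^sub>R a \<in> quasinilpotents"
  using quasinilpotents_mult_commuting[OF assms, of "r *\<^sub>R 1"] by simp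

text \<open>
  By division with remainder, \<open>a ^ m\<close> is a power of \<open>a ^ n\<close> times one of the finitely many
  \<open>a ^ i\<close> with \<open>i < n\<close>, which only affect the constant in the geometric bound.
\<close>

lemma quasinilpotents_if_power:
  fixes a :: "'a::complex_banach_algebra_1"
  assumes power: "a ^ n \<in> quasinilpotents" and n: "n \<ge> 1"
  shows "a \<in> quasinilpotents"
  unfolding quasinilpotents_iff_geometric_bound
proof (intro allI impI)
  fix e :: real assume e: "e > 0"
  obtain C where C: "C \<ge> 0" "\<And>k. norm ((a ^ n) ^ k) \<le> C * (e ^ n) ^ k"
    using quasinilpotents_bound[OF power, of "e ^ n"] e by auto
  define D where "D = (\<Sum>i<n. norm (a ^ i) / e ^ i)"
  have D: "norm (a ^ i) \<le> D * e ^ i" if "i < n" for i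
  proof -
    have "norm (a ^ i) / e ^ i \<le> D"
      unfolding D_def using e that by (intro member_le_sum) auto
    then show ?thesis
      using e by (simp add: field_simps)
  qed
  have "norm (a ^ m) \<le> (C * D) * e ^ m" for m
  proof -
    define k i where "k = m div n" and "i = m mod n"
    have m: "m = n * k + i" and i: "i < n"
      using n by (auto simp: k_def i_def)
    have "norm (a ^ m) \<le> norm ((a ^ n) ^ k) * norm (a ^ i)"
      by (simp add: m power_add power_mult norm_mult_ineq)
    also have "\<dots> \<le> (C * (e ^ n) ^ k) * (D * e ^ i)"
      using C D[OF i] e by (intro mult_mono) auto
    also have "\<dots> = (C * D) * e ^ m"
      by (simp add: m power_add power_mult)
    finally show ?thesis .
  qed
  then show "\<exists>C. \<forall>m. norm (a ^ m) \<le> C * e ^ m"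
    by blast
qed

section \<open>Bicommutants\<close>

lemma Comm2_mult: "x \<in> Comm2 a \<Longrightarrow> y \<in> Comm2 a \<Longrightarrow> x * y \<in> Comm2 a"
  unfolding Comm2_def by (auto simp: mult.assoc) (metis mult.assoc)

lemma Comm2_add: "x \<in> Comm2 a \<Longrightarrow> y \<in> Comm2 a \<Longrightarrow> x + y \<in> Comm2 a"
  by (simp add: Comm2_def algebra_simps)

lemma Comm2_diff: "x \<in> Comm2 a \<Longrightarrow> y \<in> Comm2 a \<Longrightarrow> x - y \<in> Comm2 a"
  by (simp add: Comm2_def algebra_simps)

lemma Comm2_scaleR: "x \<in> Comm2 a \<Longrightarrow> r *\<^sub>R x \<in> Comm2 a"
  by (simp add: Comm2_def)

lemma Comm2_one: "1 \<in> Comm2 a"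
  by (simp add: Comm2_def)

lemma Comm2_self: "a \<in> Comm2 a"
  by (simp add: Comm2_def Comm_def)

lemma Comm2_power: "x \<in> Comm2 a \<Longrightarrow> x ^ k \<in> Comm2 a"
  by (induction k) (auto intro: Comm2_one Comm2_mult)

lemmas Comm2_intros = Comm2_self Comm2_one Comm2_mult Comm2_add Comm2_diff Comm2_scaleR Comm2_power

text \<open>
  The bicommutant is commutative because \<open>a\<close> commutes with itself: this gives
  \<open>Comm2 a \<subseteq> Comm a\<close>, and \<open>Comm2 a\<close> centralizes \<open>Comm a\<close>.
\<close>

lemma Comm2_commute: "x \<in> Comm2 a \<Longrightarrow> y \<in> Comm2 a \<Longrightarrow> x * y = y * x"
  unfolding Comm2_def Comm_def by blast

text \<open>
  Elements obtained from \<open>a\<close> in several steps (a polynomial in \<open>a\<close>, then a power series in that)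
  are placed in \<open>Comm2 a\<close> one step at a time by this rule.
\<close>

lemma Comm2_trans:
  assumes "x \<in> Comm2 b" "b \<in> Comm2 a"
  shows "x \<in> Comm2 a"
proof -
  have "Comm a \<subseteq> Comm b"
    using assms(2) by (auto simp: Comm_def Comm2_def)
  with assms(1) show ?thesis
    by (auto simp: Comm2_def)
qed

section \<open>Real powers of one plus a quasinilpotent\<close>

text \<open>
  \<open>(1 + y) powr \<alpha>\<close> by Newton's binomial series; only meaningful when \<open>y\<close> is small, in particular
  when \<open>y\<close> is quasinilpotent.
\<close>

definition one_plus_powr :: "'a::complex_banach_algebra_1 \<Rightarrow> real \<Rightarrow> 'a" where
  "one_plus_powr y \<alpha> = (\<Sum>k. (\<alpha> gchoose k) *\<^sub>R y ^ k)"

text \<open>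
  A quasinilpotent lies inside every disc of convergence: its powers decay faster than those of
  any positive number.
\<close>

lemma summable_norm_power_series:
  fixes y :: "'a::complex_banach_algebra_1" and c :: "nat \<Rightarrow> real"
  assumes y: "y \<in> quasinilpotents" and c: "conv_radius c > 0"
  shows "summable (\<lambda>k. norm (c k *\<^sub>R y ^ k))"
proof -
  obtain e where e: "0 < e" "ereal e < conv_radius c"
    using ereal_dense2[OF c] by auto
  obtain C where C: "\<And>k. norm (y ^ k) \<le> C * e ^ k"
    using quasinilpotents_bound[OF y e(1)] by blast
  have "summable (\<lambda>k. C * norm (c k * e ^ k))"
    using e by (intro summable_mult abs_summable_in_conv_radius) simp
  then show ?thesis
  proof (rule summable_comparison_test')
    fix k :: nat
    show "norm (norm (c k *\<^sub>R y ^ k)) \<le> C * norm (c k * e ^ k)"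
      using mult_left_mono[OF C[of k], of "\<bar>c k\<bar>"] e by (simp add: abs_mult mult_ac)
  qed
qed

lemma conv_radius_gchoose_pos: "conv_radius (\<lambda>k. (\<alpha>::real) gchoose k) > 0"
  by (simp add: conv_radius_gchoose)

lemmas summable_norm_binomial_series =
  summable_norm_power_series[OF _ conv_radius_gchoose_pos]

lemmas summable_binomial_series = summable_norm_cancel[OF summable_norm_binomial_series]

text \<open>
  The law of exponents is the Cauchy product combined with the Vandermonde identity. It supplies
  both the inverse of \<open>1 + y\<close> and its inverse square root.
\<close>

lemma one_plus_powr_add:
  fixes y :: "'a::complex_banach_algebra_1"
  assumes y: "y \<in> quasinilpotents"
  shows "one_plus_powr y \<alpha> * one_plus_powr y \<beta> = one_plus_powr y (\<alpha> + \<beta>)"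
proof -
  have "one_plus_powr y \<alpha> * one_plus_powr y \<beta> =
      (\<Sum>k. \<Sum>i\<le>k. ((\<alpha> gchoose i) *\<^sub>R y ^ i) * ((\<beta> gchoose (k - i)) *\<^sub>R y ^ (k - i)))"
    unfolding one_plus_powr_def by (intro Cauchy_product summable_norm_binomial_series y)
  also have "\<dots> = (\<Sum>k. (\<Sum>i\<le>k. (\<alpha> gchoose i) * (\<beta> gchoose (k - i))) *\<^sub>R y ^ k)"
    by (simp add: scaleR_sum_left mult.commute flip: power_add)
  also have "\<dots> = one_plus_powr y (\<alpha> + \<beta>)"
    by (simp add: one_plus_powr_def gbinomial_Vandermonde flip: atLeast0AtMost)
  finally show ?thesis .
qed

lemma one_plus_powr_of_nat:
  fixes y :: "'a::complex_banach_algebra_1"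
  shows "one_plus_powr y (real n) = (\<Sum>k\<le>n. real (n choose k) *\<^sub>R y ^ k)"
  unfolding one_plus_powr_def
  by (subst suminf_finite[of "{..n}"]) (auto simp: binomial_gbinomial[symmetric])

lemma one_plus_powr_0: "one_plus_powr y 0 = 1"
  using one_plus_powr_of_nat[of y 0] by simp

lemma one_plus_powr_1: "one_plus_powr y 1 = 1 + y"
  using one_plus_powr_of_nat[of y 1] by simp

lemma one_plus_powr_Comm2:
  fixes y :: "'a::complex_banach_algebra_1"
  assumes "y \<in> quasinilpotents"
  shows "one_plus_powr y \<alpha> \<in> Comm2 y"
  unfolding Comm2_def
proof (intro CollectI ballI)
  fix z assume "z \<in> Comm y"
  then have "y ^ k * z = z * y ^ k" for k
    by (intro power_commuting_commutes) (simp add: Comm_def)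
  then show "one_plus_powr y \<alpha> * z = z * one_plus_powr y \<alpha>"
    by (simp add: one_plus_powr_def suminf_mult2 summable_binomial_series[OF assms]
        flip: suminf_mult)
qed

text \<open>
  The constant term of the series is 1, so what remains is \<open>y\<close> times a convergent series that
  commutes with \<open>y\<close>.
\<close>

lemma one_plus_powr_minus_one_quasinilpotent:
  fixes y :: "'a::complex_banach_algebra_1"
  assumes y: "y \<in> quasinilpotents"
  shows "one_plus_powr y \<alpha> - 1 \<in> quasinilpotents"
proof -
  define f where "f k = (\<alpha> gchoose Suc k) *\<^sub>R y ^ k" for k
  have summ: "summable (\<lambda>k. (\<alpha> gchoose k) *\<^sub>R y ^ k)"
    by (rule summable_binomial_series[OF y])
  have "conv_radius (\<lambda>k. \<alpha> gchoose Suc k) > 0"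
    using conv_radius_shift[of "\<lambda>k. \<alpha> gchoose k" 1] conv_radius_gchoose_pos[of \<alpha>] by simp
  then have "summable f"
    unfolding f_def by (rule summable_norm_cancel[OF summable_norm_power_series[OF y]])
  moreover have "y * f k = f k * y" for k
    by (simp add: f_def power_commutes)
  ultimately have comm: "y * suminf f = suminf f * y"
    by (simp add: suminf_mult2 flip: suminf_mult)
  have "one_plus_powr y \<alpha> - 1 = (\<Sum>k. y * f k)"
    using suminf_split_head[OF summ] by (simp add: one_plus_powr_def f_def)
  also have "\<dots> = y * suminf f"
    using \<open>summable f\<close> by (rule suminf_mult)
  finally show ?thesis
    using quasinilpotents_mult_commuting[OF y comm] by simp
qed

section \<open>Lifting along quasinilpotents\<close>

lemma one_plus_quasinilpotent_inverse:
  fixes r :: "'a::complex_banach_algebra_1"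
  assumes "r \<in> quasinilpotents"
  obtains v where "v \<in> Comm2 r" "(1 + r) * v = 1"
  using one_plus_powr_Comm2[OF assms, of "-1"] one_plus_powr_add[OF assms, of 1 "-1"]
  by (auto simp: one_plus_powr_0 one_plus_powr_1)

text \<open>
  Normalizing \<open>h\<close> by the square root of its square: with \<open>y = h * h - 1\<close>, the element
  \<open>e = h (1 + y) powr (-1/2)\<close> has square 1, and it differs from \<open>h\<close> by a multiple of
  \<open>(1 + y) powr (-1/2) - 1\<close>.
\<close>

lemma involution_lifting:
  fixes h :: "'a::complex_banach_algebra_1"
  assumes "h * h - 1 \<in> quasinilpotents"
  obtains e where "e \<in> Comm2 h" "e * e = 1" "h - e \<in> quasinilpotents"
proof -
  define y s where "y = h * h - 1" and "s = one_plus_powr y (- 1 / 2)"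
  have y: "y \<in> quasinilpotents"
    using assms by (simp add: y_def)
  have s: "s \<in> Comm2 h"
    unfolding s_def by (rule Comm2_trans[OF one_plus_powr_Comm2[OF y]])
      (auto simp: y_def intro: Comm2_intros)
  have comm: "h * s = s * h"
    by (intro Comm2_commute[of _ h] Comm2_self s)
  have "(1 + y) * (s * s) = one_plus_powr y (1 + (- 1 / 2 + - 1 / 2))"
    by (simp only: s_def one_plus_powr_add[OF y] flip: one_plus_powr_1)
  then have "(h * h) * (s * s) = 1"
    by (simp add: one_plus_powr_0 y_def)
  then have "(h * s) * (h * s) = 1"
    by (metis comm mult.assoc)
  moreover have "h - h * s \<in> quasinilpotents"
  proof -
    have "(s - 1) * (- h) \<in> quasinilpotents"
      unfolding s_def
      by (intro quasinilpotents_mult_commuting one_plus_powr_minus_one_quasinilpotent y)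
        (use comm[unfolded s_def] in \<open>simp add: algebra_simps\<close>)
    then show ?thesis
      by (simp add: algebra_simps comm)
  qed
  ultimately show ?thesis
    using that[of "h * s"] s by (blast intro: Comm2_intros)
qed

text \<open>
  Idempotents \<open>p\<close> and involutions \<open>e\<close> correspond through \<open>e = 2 p - 1\<close>; under the same
  substitution \<open>h = 2 c - 1\<close> the defect \<open>h * h - 1\<close> is \<open>-4\<close> times \<open>c - c * c\<close>.
\<close>

lemma idempotent_lifting:
  fixes c :: "'a::complex_banach_algebra_1"
  assumes "c - c * c \<in> quasinilpotents"
  obtains p where "p \<in> Comm2 c" "p * p = p" "c - p \<in> quasinilpotents"
proof -
  define h where "h = 2 *\<^sub>R c - 1"
  have "h * h - 1 = (-4) *\<^sub>R (c - c * c)"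
    by (simp add: h_def algebra_simps flip: scaleR_2)
  then have "h * h - 1 \<in> quasinilpotents"
    using quasinilpotents_scaleR[OF assms, of "-4"] by simp
  then obtain e where e: "e \<in> Comm2 h" "e * e = 1" "h - e \<in> quasinilpotents"
    by (rule involution_lifting)
  define p where "p = (1 / 2) *\<^sub>R (1 + e)"
  have "e \<in> Comm2 c"
    by (rule Comm2_trans[OF e(1)]) (auto simp: h_def intro: Comm2_intros)
  then have "p \<in> Comm2 c"
    unfolding p_def by (intro Comm2_intros)
  moreover have "p * p = p"
    using e(2) by (simp add: p_def algebra_simps flip: scaleR_add_left)
  moreover have "c - p = (1 / 2) *\<^sub>R (h - e)"
    by (simp add: p_def h_def algebra_simps)
  then have "c - p \<in> quasinilpotents"
    using quasinilpotents_scaleR[OF e(3)] by simp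
  ultimately show ?thesis
    using that by blast
qed

section \<open>The characterization\<close>

text \<open>
  Idempotency of \<open>p\<close> makes \<open>c - c * c\<close> factor as \<open>(c - p) * (1 - c - p)\<close>.
\<close>

lemma quasinilpotent_diff_square:
  fixes c p :: "'a::complex_banach_algebra_1"
  assumes "c - p \<in> quasinilpotents" "p * p = p" "c * p = p * c"
  shows "c - c * c \<in> quasinilpotents"
proof -
  have "(c - p) * (1 - c - p) \<in> quasinilpotents"
    using assms by (intro quasinilpotents_mult_commuting) (auto simp: algebra_simps)
  moreover have "(c - p) * (1 - c - p) = c - c * c"
    using assms by (simp add: algebra_simps)
  ultimately show ?thesis
    by simp
qed

text \<open>
  With \<open>c = a ^ n\<close> and \<open>b = a * (1 - c)\<close>: the identity \<open>a ^ (n - 1) * b = c - c * c\<close> gives one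
  direction, and \<open>b ^ n = (c - c * c) * (1 - c) ^ (n - 1)\<close> the other, as an element with a
  quasinilpotent power is quasinilpotent.
\<close>

lemma quasinilpotent_diff_power_Suc_iff:
  fixes a :: "'a::complex_banach_algebra_1"
  assumes n: "n \<ge> 1"
  shows "a - a ^ (n + 1) \<in> quasinilpotents \<longleftrightarrow> a ^ n - a ^ n * a ^ n \<in> quasinilpotents"
proof
  define b c where "b = a - a ^ (n + 1)" and "c = a ^ n"
  have ca: "c * a = a * c"
    by (simp add: c_def power_commutes)
  have b: "b = a * (1 - c)"
    by (simp add: b_def c_def algebra_simps)
  have b_pow: "a ^ n * (1 - c) ^ n = b ^ n"
    unfolding b using ca by (intro power_mult_distrib_commuting[symmetric]) (simp add: algebra_simps)
  have split_c: "a * a ^ (n - 1) = c"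
    using n by (cases n) (auto simp: c_def)
  {
    assume "a - a ^ (n + 1) \<in> quasinilpotents"
    then have "b * a ^ (n - 1) \<in> quasinilpotents"
      unfolding b_def[symmetric]
      by (rule quasinilpotents_mult_commuting)
        (auto simp: b_def intro!: Comm2_commute[of _ a] Comm2_intros)
    moreover have "b * a ^ (n - 1) = a ^ (n - 1) * b"
      by (auto simp: b_def intro!: Comm2_commute[of _ a] Comm2_intros)
    moreover have "a ^ (n - 1) * b = c - c * c"
      using split_c by (simp add: b power_commutes algebra_simps flip: mult.assoc)
    ultimately show "a ^ n - a ^ n * a ^ n \<in> quasinilpotents"
      by (simp add: c_def)
  next
    assume "a ^ n - a ^ n * a ^ n \<in> quasinilpotents"
    then have "(c - c * c) * (1 - c) ^ (n - 1) \<in> quasinilpotents"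
      unfolding c_def[symmetric]
      by (rule quasinilpotents_mult_commuting)
        (auto intro!: Comm2_commute[of _ c] Comm2_intros)
    moreover have "(c - c * c) * (1 - c) ^ (n - 1) = c * (1 - c) ^ n"
      using n by (cases n) (auto simp: algebra_simps)
    ultimately have "b ^ n \<in> quasinilpotents"
      using b_pow by (simp add: c_def)
    then show "a - a ^ (n + 1) \<in> quasinilpotents"
      using n quasinilpotents_if_power b_def by blast
  }
qed

theorem corollary2p5:
  fixes a :: "'a::complex_banach_algebra_1" and n :: nat
  assumes "n \<ge> 1"
  shows "gns_Drazin_invertible n a \<longleftrightarrow> a - a ^ (n + 1) \<in> quasinilpotents"
  unfolding quasinilpotent_diff_power_Suc_iff[OF assms]
proof
  assume "gns_Drazin_invertible n a"
  then obtain x where x: "x \<in> Comm2 a" "x * a * x = x" "a ^ n - a * x \<in> quasinilpotents"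
    unfolding gns_Drazin_invertible_def by blast
  show "a ^ n - a ^ n * a ^ n \<in> quasinilpotents"
  proof (rule quasinilpotent_diff_square[OF x(3)])
    show "(a * x) * (a * x) = a * x"
      using x(2) by (simp add: mult.assoc)
    show "a ^ n * (a * x) = (a * x) * a ^ n"
      by (intro Comm2_commute[of _ a] Comm2_intros x)
  qed
next
  define c where "c = a ^ n"
  assume "a ^ n - a ^ n * a ^ n \<in> quasinilpotents"
  then obtain p where p: "p \<in> Comm2 c" "p * p = p" "c - p \<in> quasinilpotents"
    using idempotent_lifting c_def by metis
  obtain v where v: "v \<in> Comm2 (c - p)" "(1 + (c - p)) * v = 1"
    using one_plus_quasinilpotent_inverse[OF p(3)] .
  have in_a: "c \<in> Comm2 a"
    unfolding c_def by (intro Comm2_intros)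
  have p_a: "p \<in> Comm2 a"
    using Comm2_trans[OF p(1) in_a] .
  have v_a: "v \<in> Comm2 a"
    by (rule Comm2_trans[OF v(1)]) (intro Comm2_intros in_a p_a)
  \<comment> \<open>On the range of \<open>p\<close>, \<open>v\<close> inverts \<open>c = a * a ^ (n - 1)\<close>; cancelling one factor \<open>a\<close>
    leaves an inverse of \<open>a\<close> there.\<close>
  define x where "x = a ^ (n - 1) * p * v"
  have x_a: "x \<in> Comm2 a"
    unfolding x_def by (intro Comm2_intros p_a v_a)
  have "a * a ^ (n - 1) = c"
    using assms by (cases n) (auto simp: c_def)
  then have "a * x = c * p * v"
    by (simp add: x_def flip: mult.assoc)
  also have "c * p = p * (1 + (c - p))"
    using p(2) Comm2_commute[OF in_a p_a] by (simp add: algebra_simps)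
  also have "p * (1 + (c - p)) * v = p"
    using v(2) by (simp add: mult.assoc)
  finally have ax: "a * x = p" .
  have "x * a * x = x * p"
    using ax by (simp add: mult.assoc)
  also have "\<dots> = p * x"
    by (rule Comm2_commute[OF x_a p_a])
  also have "p * x = (p * a ^ (n - 1)) * p * v"
    by (simp add: x_def mult.assoc)
  also have "p * a ^ (n - 1) = a ^ (n - 1) * p"
    by (intro Comm2_commute[of _ a] Comm2_intros p_a)
  also have "a ^ (n - 1) * p * p * v = x"
    using p(2) by (simp add: x_def mult.assoc)
  finally have "x * a * x = x" .
  with x_a ax p(3) show "gns_Drazin_invertible n a"
    unfolding gns_Drazin_invertible_def c_def by blast
qed

end
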